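(* Let $\mathbf n$ be a strictly increasing sequence of positive integers. A basis $\mathcal B$ of a Banach space $X$ is $1$-($\mathbf n$, strong partially greedy) if and only if it is $1$-($\mathbf n$, PSLC).
   Context: $X$ is a separable infinite-dimensional Banach space over $\mathbb F=\mathbb R$ or $\mathbb C$; $\mathbb N=\{1,2,\dots\}$. A basis of $X$ is a sequence $\mathcal B=(e_n)_{n\ge1}\subset X$ whose linear span is norm-dense and for which there is a sequence $(e_n^* )_{n\ge1}\subset X^*$ with $e_j^*(e_k)=\delta_{j,k}$ and $0<\inf_n\{\|e_n\|,\|e_n^*\|\}\le\sup_n\{\|e_n\|,\|e_n^*\|\}<\infty$ (then $e_n^*(x)\to0$ for every $x$). For a finite set $A\subset\mathbb N$, $P_A(x)=\sum_{n\in A}e_n^*(x)e_n$. For $x\in X$, $m\in\mathbb N$, a greedy set of $x$ of order $m$ is a set $A\subset\mathbb N$ with $|A|=m$ and $\min_{n\in A}|e_n^*(x)|\ge\max_{n\notin A}|e_n^*(x)|$; $G_m(x)$ denotes $P_A(x)$ for such an $A$ (not necessarily unique). The sequence $\mathbf n=(n_k)_{k\ge1}$ is identified with its set of terms; $P^{\mathbf n}_0(x)=0$, $P^{\mathbf n}_k(x)=\sum_{i=1}^k e_{n_i}^*(x)e_{n_i}$, $\widehat\sigma^{\mathbf n}_m(x)=\min_{0\le k\le m}\|x-P^{\mathbf n}_k(x)\|$. $\mathcal B$ is $1$-($\mathbf n$, strong partially greedy) if $\|x-G_m(x)\|\le\widehat\sigma^{\mathbf n}_m(x)$ for all $x\in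 X$, $m\in\mathbb N$ and all choices of $G_m(x)$. A sign is a sequence $\varepsilon=(\varepsilon_n)_n$ of scalars of modulus $1$; $1_{\varepsilon A}=\sum_{n\in A}\varepsilon_ne_n$; $\|x\|_\infty=\max_n|e_n^*(x)|$; $\operatorname{supp}(x)=\{n:e_n^*(x)\ne0\}$; $A<B$ means $a<b$ for all $a\in A,b\in B$ (vacuous if one is empty). $\mathcal B$ is $1$-($\mathbf n$, PSLC) if $\|x+1_{\varepsilon A}\|\le\|x+1_{\delta B}\|$ for all $x\in X$ with $\|x\|_\infty\le1$, all finite sets $A\subset\mathbf n$, $B\subset\mathbb N$ with $|A|\le|B|$, $B\cap\operatorname{supp}(x)=\emptyset$ and $A<(B\cup\operatorname{supp}(x))\cap\mathbf n$, and all signs $\varepsilon,\delta$. *)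

theory Defs
  imports "HOL-Analysis.Analysis"
begin

text \<open>
  The scalar field is a type of class \<^class>\<open>real_normed_field\<close>. Both \<^typ>\<open>real\<close> and
  \<^typ>\<open>complex\<close> are instances, and up to isometric isomorphism they are the only ones
  (Gelfand--Mazur, as the norm of the class is multiplicative).
  The norm of the Banach space is that of class \<^class>\<open>banach\<close>; the scalar multiplication
  by the field extends the real one. For real scalars this forces it to be
  \<^const>\<open>scaleR\<close>.
\<close>

locale separable_infinite_dim_banach = vector_space smul
  for smul :: "'k::real_normed_field \<Rightarrow> 'a::banach \<Rightarrow> 'a" +
  assumes smul_of_real: "smul (of_real r) x = r *\<^sub>R x"
    and norm_smul: "norm (smul c x) = norm c * norm x"
    and separable: "\<exists>D::'a set. countable D \<and> closure D = UNIV"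
    and infinite_dim: "\<nexists>S. finite S \<and> module.span smul S = UNIV"

definition dual_element :: "('k::real_normed_field \<Rightarrow> 'a::banach \<Rightarrow> 'a) \<Rightarrow> ('a \<Rightarrow> 'k) \<Rightarrow> bool" where
  "dual_element smul f \<longleftrightarrow> bounded_linear f \<and> (\<forall>c x. f (smul c x) = c * f x)"

text \<open>
  Sequences are indexed from 0, so the positive integer \<open>n\<close> of the mathematical text corresponds
  to the index \<open>n - 1\<close> here; only the order of the indices plays a role.
  A basis is given together with its coordinate functionals, which are uniquely
  determined by biorthogonality and density of the span. The norm of a functional
  is \<^const>\<open>onorm\<close>.
\<close>

definition is_basis ::
  "('k::real_normed_field \<Rightarrow> 'a::banach \<Rightarrow> 'a) \<Rightarrow> (nat \<Rightarrow> 'a) \<Rightarrow> (nat \<Rightarrow> 'a \<Rightarrow> 'k) \<Rightarrow> bool" where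
  "is_basis smul e e' \<longleftrightarrow>
     closure (module.span smul (range e)) = UNIV \<and>
     (\<forall>n. dual_element smul (e' n)) \<and>
     (\<forall>j k. e' j (e k) = (if j = k then 1 else 0)) \<and>
     0 < Inf (range (\<lambda>n. norm (e n)) \<union> range (\<lambda>n. onorm (e' n))) \<and>
     bdd_above (range (\<lambda>n. norm (e n)) \<union> range (\<lambda>n. onorm (e' n)))"

definition coord_proj ::
  "('k::real_normed_field \<Rightarrow> 'a::banach \<Rightarrow> 'a) \<Rightarrow> (nat \<Rightarrow> 'a) \<Rightarrow> (nat \<Rightarrow> 'a \<Rightarrow> 'k) \<Rightarrow>
    nat set \<Rightarrow> 'a \<Rightarrow> 'a" where
  "coord_proj smul e e' A x = (\<Sum>n\<in>A. smul (e' n x) (e n))"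

definition greedy_set :: "(nat \<Rightarrow> 'a::banach \<Rightarrow> 'k::real_normed_field) \<Rightarrow> 'a \<Rightarrow> nat \<Rightarrow> nat set \<Rightarrow> bool" where
  "greedy_set e' x m A \<longleftrightarrow>
     finite A \<and> card A = m \<and> (\<forall>i\<in>A. \<forall>j. j \<notin> A \<longrightarrow> norm (e' j x) \<le> norm (e' i x))"

definition partial_sum_along ::
  "('k::real_normed_field \<Rightarrow> 'a::banach \<Rightarrow> 'a) \<Rightarrow> (nat \<Rightarrow> 'a) \<Rightarrow> (nat \<Rightarrow> 'a \<Rightarrow> 'k) \<Rightarrow>
    (nat \<Rightarrow> nat) \<Rightarrow> nat \<Rightarrow> 'a \<Rightarrow> 'a" where
  "partial_sum_along smul e e' ns k x = (\<Sum>i<k. smul (e' (ns i) x) (e (ns i)))"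

definition sigma_hat ::
  "('k::real_normed_field \<Rightarrow> 'a::banach \<Rightarrow> 'a) \<Rightarrow> (nat \<Rightarrow> 'a) \<Rightarrow> (nat \<Rightarrow> 'a \<Rightarrow> 'k) \<Rightarrow>
    (nat \<Rightarrow> nat) \<Rightarrow> nat \<Rightarrow> 'a \<Rightarrow> real" where
  "sigma_hat smul e e' ns m x =
     Min ((\<lambda>k. norm (x - partial_sum_along smul e e' ns k x)) ` {0..m})"

definition one_strong_partially_greedy ::
  "('k::real_normed_field \<Rightarrow> 'a::banach \<Rightarrow> 'a) \<Rightarrow> (nat \<Rightarrow> 'a) \<Rightarrow> (nat \<Rightarrow> 'a \<Rightarrow> 'k) \<Rightarrow>
    (nat \<Rightarrow> nat) \<Rightarrow> bool" where
  "one_strong_partially_greedy smul e e' ns \<longleftrightarrow>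
     (\<forall>x m A. m \<ge> 1 \<longrightarrow> greedy_set e' x m A \<longrightarrow>
        norm (x - coord_proj smul e e' A x) \<le> sigma_hat smul e e' ns m x)"

definition is_sign :: "(nat \<Rightarrow> 'k::real_normed_field) \<Rightarrow> bool" where
  "is_sign \<epsilon> \<longleftrightarrow> (\<forall>n. norm (\<epsilon> n) = 1)"

definition signed_indicator ::
  "('k::real_normed_field \<Rightarrow> 'a::banach \<Rightarrow> 'a) \<Rightarrow> (nat \<Rightarrow> 'a) \<Rightarrow> (nat \<Rightarrow> 'k) \<Rightarrow> nat set \<Rightarrow> 'a" where
  "signed_indicator smul e \<epsilon> A = (\<Sum>n\<in>A. smul (\<epsilon> n) (e n))"

text \<open>
  The supremum below is attained, since the coordinates of a vector with respect to a basis tend to 0.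
\<close>

definition coord_sup_norm :: "(nat \<Rightarrow> 'a::banach \<Rightarrow> 'k::real_normed_field) \<Rightarrow> 'a \<Rightarrow> real" where
  "coord_sup_norm e' x = (SUP n. norm (e' n x))"

definition coord_supp :: "(nat \<Rightarrow> 'a::banach \<Rightarrow> 'k::real_normed_field) \<Rightarrow> 'a \<Rightarrow> nat set" where
  "coord_supp e' x = {n. e' n x \<noteq> 0}"

definition set_before :: "nat set \<Rightarrow> nat set \<Rightarrow> bool" where
  "set_before A B \<longleftrightarrow> (\<forall>a\<in>A. \<forall>b\<in>B. a < b)"

definition one_PSLC ::
  "('k::real_normed_field \<Rightarrow> 'a::banach \<Rightarrow> 'a) \<Rightarrow> (nat \<Rightarrow> 'a) \<Rightarrow> (nat \<Rightarrow> 'a \<Rightarrow> 'k) \<Rightarrow>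
    (nat \<Rightarrow> nat) \<Rightarrow> bool" where
  "one_PSLC smul e e' ns \<longleftrightarrow>
     (\<forall>x A B \<epsilon> \<delta>.
        coord_sup_norm e' x \<le> 1 \<longrightarrow>
        finite A \<longrightarrow> finite B \<longrightarrow> A \<subseteq> range ns \<longrightarrow> card A \<le> card B \<longrightarrow>
        B \<inter> coord_supp e' x = {} \<longrightarrow>
        set_before A ((B \<union> coord_supp e' x) \<inter> range ns) \<longrightarrow>
        is_sign \<epsilon> \<longrightarrow> is_sign \<delta> \<longrightarrow>
        norm (x + signed_indicator smul e \<epsilon> A) \<le> norm (x + signed_indicator smul e \<delta> B))"

end

theory Submission imports Defs begin

text \<open>
  Both directions compare two vectors that agree up to finitely many coordinates.

  Suppose first that the basis is strong partially greedy, and let \<open>x\<close>, \<open>A\<close>, \<open>B\<close> be as in the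
  definition of PSLC. Let \<open>D\<close> be the shortest initial segment of the sequence that contains \<open>A\<close>.
  As \<open>A\<close> precedes the terms of the sequence in \<open>B\<close> and in the support of \<open>x\<close>, the segment \<open>D\<close> meets
  neither. So one can add to \<open>x\<close> a coefficient of modulus 1 at every point of \<open>D \<union> B\<close>, taken
  from \<open>\<epsilon>\<close> on \<open>A\<close> and from \<open>\<delta>\<close> on \<open>B\<close>: then \<open>(D - A) \<union> B\<close> is a greedy set, of order
  at least \<open>card D\<close> because \<open>card A \<le> card B\<close>, whose removal leaves
  \<open>x + 1\<^sub>\<epsilon>\<^sub>A\<close>, while removal of the partial sum over \<open>D\<close> leaves \<open>x + 1\<^sub>\<delta>\<^sub>B\<close>.

  Conversely assume PSLC, let \<open>A\<close> be a greedy set of \<open>x\<close>, let \<open>t\<close> be a threshold separating the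
  moduli of the coordinates in \<open>A\<close> from the others, and let \<open>D\<close> be an initial segment of the sequence
  with \<open>card D \<le> card A\<close>. Put \<open>z = x - P\<^bsub>A \<union> D\<^esub> x\<close>, so that the two
  remainders are \<open>z\<close> plus the part of \<open>x\<close> over \<open>D - A\<close>, where the coordinates have modulus at most
  \<open>t\<close>, and \<open>z\<close> plus the part of \<open>x\<close> over \<open>A - D\<close>, where they have modulus at least \<open>t\<close>. The first
  is a convex combination of vectors \<open>z + t 1\<^sub>\<epsilon>\<close> over \<open>D - A\<close>
  (\<open>norm_add_lincomb_le_of_signs\<close>); PSLC, homogenised in \<open>PSLC_scaled\<close>, moves these to
  \<open>z + t 1\<^sub>\<delta>\<close> over \<open>A - D\<close>; and with constant 1, raising the coefficients from \<open>t\<close> to their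
  true size does not decrease the norm (\<open>PSLC_truncation\<close>).
\<close>

section \<open>Coordinates and finite linear combinations\<close>

text \<open>
  The value 1 at 0 makes every sequence of phases a sign.
\<close>

definition phase :: "'k::real_normed_field \<Rightarrow> 'k" where
  "phase c = (if c = 0 then 1 else sgn c)"

lemma norm_phase [simp]: "norm (phase c) = 1"
  by (simp add: phase_def norm_sgn)

lemma norm_times_phase: "of_real (norm c) * phase c = c"
  by (simp add: phase_def sgn_div_norm scaleR_conv_of_real)

lemma norm_convex_combination_le:
  fixes a b :: "'a::real_normed_vector"
  assumes "norm a \<le> M" "norm b \<le> M" "0 \<le> s" "s \<le> 1"
  shows "norm ((1 - s) *\<^sub>R a + s *\<^sub>R b) \<le> M"
  using convexD[OF convex_cball[of 0 M], of a b "1 - s" s] assms by simp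

locale banach_space_basis = separable_infinite_dim_banach smul
  for smul :: "'k::real_normed_field \<Rightarrow> 'a::banach \<Rightarrow> 'a" +
  fixes e :: "nat \<Rightarrow> 'a" and e' :: "nat \<Rightarrow> 'a \<Rightarrow> 'k"
  assumes basis: "is_basis smul e e'"
begin

abbreviation lincomb :: "(nat \<Rightarrow> 'k) \<Rightarrow> nat set \<Rightarrow> 'a" where
  "lincomb c A \<equiv> \<Sum>n\<in>A. smul (c n) (e n)"

lemma bounded_linear_coord: "bounded_linear (e' n)"
  and coord_smul: "e' n (smul c x) = c * e' n x"
  and coord_basis: "e' n (e k) = (if n = k then 1 else 0)"
  using basis by (auto simp: is_basis_def dual_element_def)

lemmas coord_add = linear_add[OF bounded_linear.linear[OF bounded_linear_coord]]
  and coord_diff = linear_diff[OF bounded_linear.linear[OF bounded_linear_coord]]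
  and coord_scaleR = linear_cmul[OF bounded_linear.linear[OF bounded_linear_coord]]
  and coord_sum = linear_sum[OF bounded_linear.linear[OF bounded_linear_coord]]

lemma coord_lincomb:
  assumes "finite A"
  shows "e' n (lincomb c A) = (if n \<in> A then c n else 0)"
  using assms by (simp add: coord_sum coord_smul coord_basis if_distrib sum.delta cong: if_cong)

lemma bdd_above_coords: "bdd_above (range (\<lambda>n. norm (e' n x)))"
proof -
  have "bdd_above (range (\<lambda>n. onorm (e' n)))"
    using basis by (simp add: is_basis_def)
  then obtain K where K: "onorm (e' n) \<le> K" for n
    by (auto simp: bdd_above_def)
  have "norm (e' n x) \<le> K * norm x" for n
    using onorm[OF bounded_linear_coord, of n x] mult_right_mono[OF K norm_ge_zero]
    by (rule order_trans)
  then show ?thesis by (intro bdd_aboveI2)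
qed

lemma coord_sup_norm_le_iff: "coord_sup_norm e' x \<le> t \<longleftrightarrow> (\<forall>n. norm (e' n x) \<le> t)"
  unfolding coord_sup_norm_def by (subst cSUP_le_iff[OF _ bdd_above_coords]) auto

section \<open>Consequences of PSLC with constant 1\<close>

text \<open>
  A scalar of modulus at most \<open>t\<close> lies on the segment between two opposite scalars of modulus \<open>t\<close>;
  replacing coefficients one at a time, the ball of radius \<open>M\<close> being convex, gives the bound
  over an arbitrary field of scalars.
\<close>

lemma norm_add_lincomb_le_of_signs:
  assumes "finite D" and "\<And>n. n \<in> D \<Longrightarrow> norm (c n) \<le> t"
    and "\<And>\<epsilon>. is_sign \<epsilon> \<Longrightarrow> norm (z + t *\<^sub>R lincomb \<epsilon> D) \<le> M"
  shows "norm (z + lincomb c D) \<le> M"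
  using assms
proof (induction D arbitrary: z rule: finite_induct)
  case empty
  from empty(2)[of "\<lambda>_. 1"] show ?case by (simp add: is_sign_def)
next
  case (insert d D)
  define u where "u = phase (c d)"
  have cd: "norm (c d) \<le> t" using insert.prems(1) by simp
  have end_point: "norm (z + t *\<^sub>R smul v (e d) + lincomb c D) \<le> M" if v: "norm v = 1" for v
  proof (rule insert.IH)
    fix \<epsilon> :: "nat \<Rightarrow> 'k" assume "is_sign \<epsilon>"
    then have "norm (z + t *\<^sub>R lincomb (\<epsilon>(d := v)) (insert d D)) \<le> M"
      by (intro insert.prems(2)) (simp add: is_sign_def v)
    moreover have "lincomb (\<epsilon>(d := v)) D = lincomb \<epsilon> D"
      using insert.hyps(2) by (intro sum.cong) auto
    ultimately show "norm (z + t *\<^sub>R smul v (e d) + t *\<^sub>R lincomb \<epsilon> D) \<le> M"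
      using insert.hyps by (simp add: scaleR_add_right add.assoc)
  qed (use insert.prems(1) in auto)
  \<comment> \<open>The weight that produces \<open>c d\<close> from \<open>- t u\<close> and \<open>t u\<close>; for \<open>t = 0\<close> division by zero gives
     \<open>1/2\<close>, which is as good as any.\<close>
  define s where "s = (1 + norm (c d) / t) / 2"
  have t: "0 \<le> t" using cd norm_ge_zero order_trans by blast
  have s: "0 \<le> s" "s \<le> 1" using cd t unfolding s_def by (auto simp: divide_simps)
  have st: "(2 * s - 1) * t = norm (c d)" using cd t unfolding s_def by (cases "t = 0") (auto simp: field_simps)
  have "smul (c d) (e d) = norm (c d) *\<^sub>R smul u (e d)"
    unfolding u_def by (simp add: norm_times_phase flip: smul_of_real)
  also have "\<dots> = (1 - s) *\<^sub>R t *\<^sub>R smul (- u) (e d) + s *\<^sub>R t *\<^sub>R smul u (e d)"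
    unfolding st[symmetric] by (simp add: algebra_simps flip: scaleR_2)
  finally have "z + lincomb c (insert d D)
      = (1 - s) *\<^sub>R (z + t *\<^sub>R smul (- u) (e d) + lincomb c D)
        + s *\<^sub>R (z + t *\<^sub>R smul u (e d) + lincomb c D)"
    using insert.hyps by (simp add: algebra_simps)
  then show ?case
    using norm_convex_combination_le[OF end_point[of "- u"] end_point[of u] s]
    by (simp add: u_def)
qed

lemma PSLC_scaled:
  assumes PSLC: "one_PSLC smul e e' ns"
    and x: "\<And>n. norm (e' n x) \<le> t"
    and sets: "finite A" "finite B" "A \<subseteq> range ns" "card A \<le> card B"
      "B \<inter> coord_supp e' x = {}" "set_before A ((B \<union> coord_supp e' x) \<inter> range ns)"
    and signs: "is_sign \<epsilon>" "is_sign \<delta>"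
  shows "norm (x + t *\<^sub>R lincomb \<epsilon> A) \<le> norm (x + t *\<^sub>R lincomb \<delta> B)"
proof (cases "t = 0")
  case False
  then have t: "t > 0" using x[of 0] norm_ge_zero[of "e' 0 x"] by linarith
  define y where "y = (1 / t) *\<^sub>R x"
  have supp: "coord_supp e' y = coord_supp e' x"
    using t by (simp add: y_def coord_supp_def coord_scaleR)
  have "coord_sup_norm e' y \<le> 1"
    using x t by (simp add: coord_sup_norm_le_iff y_def coord_scaleR)
  with PSLC sets signs have "norm (y + lincomb \<epsilon> A) \<le> norm (y + lincomb \<delta> B)"
    unfolding one_PSLC_def signed_indicator_def supp[symmetric] by blast
  then have "norm (t *\<^sub>R (y + lincomb \<epsilon> A)) \<le> norm (t *\<^sub>R (y + lincomb \<delta> B))"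
    using t by simp
  then show ?thesis using t by (simp add: y_def scaleR_add_right)
qed simp

text \<open>
  By convexity it is enough that deleting the coefficient \<open>c b\<close> does not increase the norm, and PSLC
  with empty \<open>A\<close> and \<open>B = {b}\<close> gives this as long as no other coordinate exceeds \<open>norm (c b)\<close>.
\<close>

lemma PSLC_raise_coefficient:
  assumes PSLC: "one_PSLC smul e e' ns"
    and w: "\<And>n. norm (e' n w) \<le> norm (c b)" "e' b w = 0"
    and t: "0 \<le> t" "t \<le> norm (c b)"
  shows "norm (w + t *\<^sub>R smul (phase (c b)) (e b)) \<le> norm (w + smul (c b) (e b))"
proof (cases "c b = 0")
  case False
  define r where "r = norm (c b)"
  have r: "r > 0" using False by (simp add: r_def)
  have cb: "smul (c b) (e b) = r *\<^sub>R smul (phase (c b)) (e b)"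
    unfolding r_def by (simp add: norm_times_phase flip: smul_of_real)
  have "norm (w + r *\<^sub>R lincomb (\<lambda>n. phase (c n)) {})
      \<le> norm (w + r *\<^sub>R lincomb (\<lambda>n. phase (c n)) {b})"
    using w by (intro PSLC_scaled[OF PSLC])
      (auto simp: r_def coord_supp_def set_before_def is_sign_def)
  then have "norm w \<le> norm (w + smul (c b) (e b))" by (simp add: cb)
  moreover have "w + t *\<^sub>R smul (phase (c b)) (e b)
      = (1 - t / r) *\<^sub>R w + (t / r) *\<^sub>R (w + smul (c b) (e b))"
    using r by (simp add: cb algebra_simps)
  ultimately show ?thesis
    using norm_convex_combination_le[of w _ "w + smul (c b) (e b)" "t / r"] t r
    by (simp add: r_def)
qed (use t in simp)

text \<open>
  The coefficients are raised from \<open>t\<close> one at a time in order of increasing final modulus, so that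
  the coefficient being raised always dominates all others.
\<close>

lemma PSLC_truncation:
  assumes PSLC: "one_PSLC smul e e' ns" and "finite B"
    and "\<And>n. norm (e' n z) \<le> t" and "B \<inter> coord_supp e' z = {}"
    and "\<And>n. n \<in> B \<Longrightarrow> t \<le> norm (c n)"
  shows "norm (z + t *\<^sub>R lincomb (\<lambda>n. phase (c n)) B) \<le> norm (z + lincomb c B)"
  using assms(2-)
proof (induction B arbitrary: z rule: finite_ranking_induct[where f = "\<lambda>n. norm (c n)"])
  case empty
  then show ?case by simp
next
  case (insert b B)
  show ?case
  proof (cases "b \<in> B")
    case True
    then show ?thesis using insert by (simp add: insert_absorb)
  next
    case False
    have t: "0 \<le> t" "t \<le> norm (c b)"
      using insert.prems(1)[of 0] insert.prems(3)[of b] norm_ge_zero order_trans by blast+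
    let ?w = "z + t *\<^sub>R smul (phase (c b)) (e b)"
    have coord_w: "e' n ?w = (if n = b then of_real t * phase (c b) else e' n z)" for n
      using insert.prems(2)
      by (auto simp: coord_add coord_scaleR coord_smul coord_basis coord_supp_def
          scaleR_conv_of_real)
    have "norm (?w + t *\<^sub>R lincomb (\<lambda>n. phase (c n)) B) \<le> norm (?w + lincomb c B)"
    proof (rule insert.IH)
      show "norm (e' n ?w) \<le> t" for n
        using insert.prems(1)[of n] t(1) by (simp add: coord_w norm_mult)
      show "B \<inter> coord_supp e' ?w = {}"
        using insert.prems(2) False by (auto simp: coord_supp_def coord_w)
    qed (use insert.prems(3) in simp)
    also have "\<dots> = norm ((z + lincomb c B) + t *\<^sub>R smul (phase (c b)) (e b))"
      by (simp add: algebra_simps)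
    also have "\<dots> \<le> norm ((z + lincomb c B) + smul (c b) (e b))"
    proof (rule PSLC_raise_coefficient[where c = c and b = b, OF PSLC _ _ t])
      have zB: "e' n z = 0" if "n \<in> insert b B" for n
        using insert.prems(2) that by (auto simp: coord_supp_def)
      show "e' b (z + lincomb c B) = 0"
        using zB False insert.hyps(1) by (simp add: coord_add coord_lincomb)
      show "norm (e' n (z + lincomb c B)) \<le> norm (c b)" for n
        using zB[of n] insert.hyps insert.prems(1)[of n] t(2)
        by (auto simp: coord_add coord_lincomb)
    qed
    finally show ?thesis
      using insert.hyps(1) False by (simp add: algebra_simps)
  qed
qed

section \<open>The equivalence\<close>

lemma partial_sum_along_eq_lincomb:
  assumes "strict_mono ns"
  shows "partial_sum_along smul e e' ns k x = lincomb (\<lambda>n. e' n x) (ns ` {..<k})"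
  unfolding partial_sum_along_def
  by (subst sum.reindex) (auto simp: strict_mono_imp_inj_on[OF assms] intro: inj_on_subset)

lemma sigma_hat_le:
  assumes "k \<le> m"
  shows "sigma_hat smul e e' ns m x \<le> norm (x - partial_sum_along smul e e' ns k x)"
  unfolding sigma_hat_def using assms by (intro Min_le) auto

lemma PSLC_imp_strong_partially_greedy:
  assumes PSLC: "one_PSLC smul e e' ns" and ns: "strict_mono ns"
  shows "one_strong_partially_greedy smul e e' ns"
proof -
  have remainder_le: "norm (x - coord_proj smul e e' A x)
      \<le> norm (x - partial_sum_along smul e e' ns k x)"
    if m: "m \<ge> 1" and A: "greedy_set e' x m A" and k: "k \<le> m" for x m A k
  proof -
    define D where "D = ns ` {..<k}"
    define z where "z = x - lincomb (\<lambda>n. e' n x) (A \<union> D)"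
    define t where "t = Min ((\<lambda>n. norm (e' n x)) ` A)"
    have finA: "finite A" and cardA: "card A = m"
      and greedy: "\<And>i j. i \<in> A \<Longrightarrow> j \<notin> A \<Longrightarrow> norm (e' j x) \<le> norm (e' i x)"
      using A by (auto simp: greedy_set_def)
    have A_ne: "A \<noteq> {}" using cardA m by auto
    have finD: "finite D" by (simp add: D_def)
    have "card D \<le> card A"
      using k card_image_le[of "{..<k}" ns] by (simp add: D_def cardA)
    then have card: "card (D - A) \<le> card (A - D)"
      using finA finD card_le_sym_Diff by blast
    have t_le: "t \<le> norm (e' n x)" if "n \<in> A" for n
      using that finA by (simp add: t_def)
    have le_t: "norm (e' n x) \<le> t" if "n \<notin> A" for n
      unfolding t_def using that finA A_ne greedy by (subst Min_ge_iff) auto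
    have t: "0 \<le> t" unfolding t_def using finA A_ne by (subst Min_ge_iff) auto
    have coord_z: "e' n z = (if n \<in> A \<union> D then 0 else e' n x)" for n
      using finA finD by (simp add: z_def coord_diff coord_lincomb)
    have z_le: "norm (e' n z) \<le> t" for n
      using le_t[of n] t by (simp add: coord_z)
    have disj: "(A - D) \<inter> coord_supp e' z = {}"
      by (auto simp: coord_supp_def coord_z)
    have before: "set_before (D - A) ((A - D \<union> coord_supp e' z) \<inter> range ns)"
      unfolding set_before_def
    proof (intro ballI)
      fix a b assume a: "a \<in> D - A" and b: "b \<in> (A - D \<union> coord_supp e' z) \<inter> range ns"
      obtain i where i: "a = ns i" "i < k" using a by (auto simp: D_def)
      obtain j where j: "b = ns j" using b by auto
      have "b \<notin> D" using b by (auto simp: coord_supp_def coord_z split: if_splits)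
      then have "k \<le> j" using j by (auto simp: D_def)
      with i j ns show "a < b" by (simp add: strict_mono_less)
    qed
    have "lincomb (\<lambda>n. e' n x) (A \<union> D)
        = lincomb (\<lambda>n. e' n x) A + lincomb (\<lambda>n. e' n x) (D - A)"
      using finA finD sum.union_disjoint[of A "D - A"] by (simp add: Un_Diff_cancel)
    then have left: "x - coord_proj smul e e' A x = z + lincomb (\<lambda>n. e' n x) (D - A)"
      by (simp add: z_def coord_proj_def)
    have "lincomb (\<lambda>n. e' n x) (A \<union> D)
        = lincomb (\<lambda>n. e' n x) D + lincomb (\<lambda>n. e' n x) (A - D)"
      using finA finD sum.union_disjoint[of D "A - D"] by (simp add: Un_Diff_cancel Un_commute)
    then have right: "x - partial_sum_along smul e e' ns k x
        = z + lincomb (\<lambda>n. e' n x) (A - D)"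
      by (simp add: z_def partial_sum_along_eq_lincomb[OF ns] D_def)
    have "norm (z + lincomb (\<lambda>n. e' n x) (D - A))
        \<le> norm (z + t *\<^sub>R lincomb (\<lambda>n. phase (e' n x)) (A - D))"
    proof (rule norm_add_lincomb_le_of_signs)
      fix \<epsilon> :: "nat \<Rightarrow> 'k" assume "is_sign \<epsilon>"
      then show "norm (z + t *\<^sub>R lincomb \<epsilon> (D - A))
          \<le> norm (z + t *\<^sub>R lincomb (\<lambda>n. phase (e' n x)) (A - D))"
        using finA finD z_le card disj before
        by (intro PSLC_scaled[OF PSLC]) (auto simp: is_sign_def D_def)
    qed (use finD le_t in auto)
    also have "\<dots> \<le> norm (z + lincomb (\<lambda>n. e' n x) (A - D))"
      using finA z_le disj t_le by (intro PSLC_truncation[OF PSLC]) auto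
    finally show ?thesis by (simp add: left right)
  qed
  show ?thesis
    unfolding one_strong_partially_greedy_def sigma_hat_def
    using remainder_le by (auto intro!: Min.boundedI)
qed

lemma strong_partially_greedy_imp_PSLC:
  assumes greedy: "one_strong_partially_greedy smul e e' ns" and ns: "strict_mono ns"
  shows "one_PSLC smul e e' ns"
  unfolding one_PSLC_def signed_indicator_def
proof (intro allI impI)
  fix x A B and \<epsilon> \<delta> :: "nat \<Rightarrow> 'k"
  assume "coord_sup_norm e' x \<le> 1"
    and fin: "finite A" "finite B" and A: "A \<subseteq> range ns" and card: "card A \<le> card B"
    and disj: "B \<inter> coord_supp e' x = {}"
    and before: "set_before A ((B \<union> coord_supp e' x) \<inter> range ns)"
    and signs: "is_sign \<epsilon>" "is_sign \<delta>"
  then have x: "norm (e' n x) \<le> 1" for n by (simp add: coord_sup_norm_le_iff)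
  show "norm (x + lincomb \<epsilon> A) \<le> norm (x + lincomb \<delta> B)"
  proof (cases "B = {}")
    case True
    then show ?thesis using card fin by simp
  next
    case False
    \<comment> \<open>The least \<open>k\<close> such that the first \<open>k\<close> terms exhaust \<open>A\<close>: for nonempty \<open>A\<close> the last of them
       lies in \<open>A\<close>, which keeps them all away from \<open>B\<close> and from the support of \<open>x\<close>.\<close>
    define k where "k = (LEAST k. A \<subseteq> ns ` {..<k})"
    define D where "D = ns ` {..<k}"
    obtain I where I: "finite I" "A = ns ` I"
      using A fin(1) finite_subset_image[of A ns UNIV] by auto
    obtain N where "I \<subseteq> {..<N}" using I(1) finite_nat_bounded by blast
    then have "A \<subseteq> ns ` {..<N}" using I(2) by blast
    then have AD: "A \<subseteq> D" unfolding D_def k_def by (rule LeastI)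
    have finD: "finite D" by (simp add: D_def)
    have cardD: "card D = k"
      unfolding D_def using ns by (simp add: card_image strict_mono_imp_inj_on inj_on_subset)
    have D_clear: "D \<inter> (B \<union> coord_supp e' x) = {}"
    proof (rule ccontr)
      assume "D \<inter> (B \<union> coord_supp e' x) \<noteq> {}"
      then obtain i where i: "i < k" "ns i \<in> B \<union> coord_supp e' x"
        by (auto simp: D_def)
      have "A \<subseteq> ns ` {..<i}"
      proof
        fix a assume a: "a \<in> A"
        then obtain j where j: "a = ns j" using I by auto
        have "a < ns i" using before a i(2) by (auto simp: set_before_def)
        then show "a \<in> ns ` {..<i}" using j ns by (simp add: strict_mono_less)
      qed
      then show False using i(1) not_less_Least[of i "\<lambda>k. A \<subseteq> ns ` {..<k}"]
        by (simp add: k_def)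
    qed
    define G where "G = (D - A) \<union> B"
    define c where "c n = (if n \<in> B then \<delta> n else \<epsilon> n)" for n
    define y where "y = x + lincomb c (D \<union> B)"
    have c1: "norm (c n) = 1" for n using signs by (simp add: c_def is_sign_def)
    have coord_y: "e' n y = (if n \<in> D \<union> B then c n else e' n x)" for n
      using D_clear disj fin finD
      by (auto simp: y_def coord_add coord_lincomb coord_supp_def)
    have "card G = card (D - A) + card B"
      unfolding G_def using fin finD D_clear by (intro card_Un_disjoint) auto
    then have kG: "k \<le> card G"
      using AD card card_mono[OF finD AD] by (simp add: card_Diff_subset fin(1) cardD)
    have G: "greedy_set e' y (card G) G"
      unfolding greedy_set_def using fin finD x by (auto simp: G_def coord_y c1)
    have "card G \<ge> 1"
      using False fin finD by (simp add: G_def Suc_le_eq card_gt_0_iff)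
    with greedy G have "norm (y - coord_proj smul e e' G y)
        \<le> sigma_hat smul e e' ns (card G) y"
      unfolding one_strong_partially_greedy_def by blast
    also have "\<dots> \<le> norm (y - partial_sum_along smul e e' ns k y)"
      using kG by (rule sigma_hat_le)
    finally have main: "norm (y - lincomb (\<lambda>n. e' n y) G) \<le> norm (y - lincomb (\<lambda>n. e' n y) D)"
      by (simp add: coord_proj_def partial_sum_along_eq_lincomb[OF ns] D_def)
    have coords_G: "lincomb (\<lambda>n. e' n y) G = lincomb c G"
      by (rule sum.cong) (auto simp: coord_y G_def)
    have coords_D: "lincomb (\<lambda>n. e' n y) D = lincomb c D"
      by (rule sum.cong) (auto simp: coord_y)
    have cA: "lincomb c A = lincomb \<epsilon> A"
      using AD D_clear by (intro sum.cong) (auto simp: c_def)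
    have cB: "lincomb c B = lincomb \<delta> B"
      by (intro sum.cong) (auto simp: c_def)
    have "D \<union> B = A \<union> G" "A \<inter> G = {}"
      using AD D_clear by (auto simp: G_def)
    then have "lincomb c (D \<union> B) = lincomb c A + lincomb c G"
      using fin finD by (simp add: sum.union_disjoint G_def)
    then have "y - lincomb c G = x + lincomb \<epsilon> A"
      by (simp add: y_def cA)
    moreover have "lincomb c (D \<union> B) = lincomb c D + lincomb c B"
      using fin finD D_clear by (intro sum.union_disjoint) auto
    then have "y - lincomb c D = x + lincomb \<delta> B"
      by (simp add: y_def cB)
    ultimately show ?thesis using main by (simp add: coords_G coords_D)
  qed
qed

end

theorem theorem5p1:
  fixes smul :: "'k::real_normed_field \<Rightarrow> 'a::banach \<Rightarrow> 'a"
    and e :: "nat \<Rightarrow> 'a" and e' :: "nat \<Rightarrow> 'a \<Rightarrow> 'k"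
    and ns :: "nat \<Rightarrow> nat"
  assumes "separable_infinite_dim_banach smul"
    and "is_basis smul e e'"
    and "strict_mono ns"
  shows "one_strong_partially_greedy smul e e' ns \<longleftrightarrow> one_PSLC smul e e' ns"
proof -
  interpret banach_space_basis smul e e'
    using assms(1,2) by (intro banach_space_basis.intro banach_space_basis_axioms.intro)
  show ?thesis
    using PSLC_imp_strong_partially_greedy strong_partially_greedy_imp_PSLC assms(3) by blast
qed

end
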